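(* Let $n, r$ be integers with $n \geq 0$ and $r \geq 2$, and let $(S_1, S_2)$ be an Euler pair of order $r$. Then (i) $a_r(n) = \dfrac{1}{r-1}\, b_r(n)$; (ii) $c_r(n) = \dfrac{1}{r-1}\, b_r(n)$.
   Context: $\mathbb N$ denotes the set of positive integers. A partition $\lambda$ of $n\ge 0$ is a non-increasing sequence of positive integers (its parts) with sum $n$; its length $\ell(\lambda)$ is its number of parts, counted with multiplicity. "A part is repeated at most $m$ times" (at least $m$ times, etc.) means that its multiplicity in the partition is at most $m$ (at least $m$, etc.). Let $r \ge 2$ and $S_1, S_2 \subseteq \mathbb N$. Let $\mathcal O_r(n)$ be the set of partitions of $n$ with all parts in $S_2$, and let $\mathcal D_r(n)$ be the set of partitions of $n$ with all parts in $S_1$ and each part repeated at most $r-1$ times. The pair $(S_1,S_2)$ is an Euler pair of order $r$ if $|\mathcal O_r(n)| = |\mathcal D_r(n)|$ for all $n \ge 0$; by a theorem of Subbarao, this is equivalent to $rS_1 \subseteq S_1$ and $S_2 = S_1 \setminus rS_1$, where $rS_1 = \{rm : m \in S_1\}$. Let $\mathcal O_{1,r}(n)$ be the set of partitions of $n$ with all parts in $S_1$ such that the set of (distinct) parts lying in $rS_1$ has exactly one element (this part may be repeated). Let $\mathcal D_{1,r}(n)$ be the set of partitions of $n$ with all parts in $S_1$ in which exactly one part (as a value) is repeated at least $r$ times. Put $$a_r(n) = |\mathcal O_{1,r}(n)|, \qquad c_r(n) = |\mathcal D_{1,r}(n)|, \qquad b_r(n) = \sum_{\lambda \in \mathcal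 O_r(n)} \ell(\lambda) - \sum_{\lambda \in \mathcal D_r(n)} \ell(\lambda).$$ *)

theory Defs
  imports Complex_Main
begin

text \<open>
  A partition is the list of its parts in non-increasing order; its length is \<open>length\<close>, and the
  multiplicity of a part is \<open>count_list\<close>.
\<close>

definition partitions :: "nat \<Rightarrow> nat list set" where
  "partitions n = {xs. sorted_wrt (\<ge>) xs \<and> (\<forall>p\<in>set xs. p > 0) \<and> sum_list xs = n}"

lemma finite_partitions: "finite (partitions n)"
proof (rule finite_subset)
  have "length xs \<le> sum_list xs" if "\<forall>p\<in>set xs. p > 0" for xs :: "nat list"
    using that by (induction xs) auto
  then show "partitions n \<subseteq> {xs. set xs \<subseteq> {..n} \<and> length xs \<le> n}"
    by (auto simp: partitions_def intro: member_le_sum_list)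
  show "finite {xs. set xs \<subseteq> {..n} \<and> length xs \<le> n}"
    by (rule finite_lists_length_le) simp
qed

definition O_parts :: "nat set \<Rightarrow> nat \<Rightarrow> nat list set" where
  "O_parts S2 n = {xs \<in> partitions n. set xs \<subseteq> S2}"

definition D_parts :: "nat \<Rightarrow> nat set \<Rightarrow> nat \<Rightarrow> nat list set" where
  "D_parts r S1 n = {xs \<in> partitions n. set xs \<subseteq> S1 \<and> (\<forall>p\<in>set xs. count_list xs p \<le> r - 1)}"

definition euler_pair :: "nat \<Rightarrow> nat set \<Rightarrow> nat set \<Rightarrow> bool" where
  "euler_pair r S1 S2 \<longleftrightarrow> S1 \<subseteq> {1..} \<and> S2 \<subseteq> {1..} \<and>
     (\<forall>n. card (O_parts S2 n) = card (D_parts r S1 n))"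

definition O1_parts :: "nat \<Rightarrow> nat set \<Rightarrow> nat \<Rightarrow> nat list set" where
  "O1_parts r S1 n =
     {xs \<in> partitions n. set xs \<subseteq> S1 \<and> card (set xs \<inter> (\<lambda>m. r * m) ` S1) = 1}"

definition D1_parts :: "nat \<Rightarrow> nat set \<Rightarrow> nat \<Rightarrow> nat list set" where
  "D1_parts r S1 n =
     {xs \<in> partitions n. set xs \<subseteq> S1 \<and> card {p \<in> set xs. count_list xs p \<ge> r} = 1}"

definition a_count :: "nat \<Rightarrow> nat set \<Rightarrow> nat \<Rightarrow> nat" where
  "a_count r S1 n = card (O1_parts r S1 n)"

definition c_count :: "nat \<Rightarrow> nat set \<Rightarrow> nat \<Rightarrow> nat" where
  "c_count r S1 n = card (D1_parts r S1 n)"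

definition b_diff :: "nat \<Rightarrow> nat set \<Rightarrow> nat set \<Rightarrow> nat \<Rightarrow> int" where
  "b_diff r S1 S2 n =
     (\<Sum>xs\<in>O_parts S2 n. int (length xs)) - (\<Sum>xs\<in>D_parts r S1 n. int (length xs))"

end

theory Submission
  imports Defs "HOL-Library.Multiset" "HOL-Computational_Algebra.Formal_Power_Series"
begin

text \<open>
  For a set \<open>A\<close> of positive integers let \<open>P A\<close> be the generating function of partitions into
  parts from \<open>A\<close>, and \<open>U A\<close> that of partitions with exactly one distinct part, taken from \<open>A\<close>.
  Marking a nonempty block of equal parts shows that the lengths in \<open>P A\<close> have generating function
  \<open>P A * U A\<close>. Dividing each multiplicity by \<open>r\<close> with remainder gives \<open>P S1 = D * P (r S1)\<close>,
  where \<open>D\<close> counts the partitions with multiplicities below \<open>r\<close>; following the lengths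
  through this bijection and cancelling \<open>P (r S1)\<close>, their total length has generating
  function \<open>D * (U S1 - r U (r S1))\<close>. For an Euler pair \<open>D = P S2\<close>, and comparing coefficients
  in \<open>P S1 = P S2 * P (r S1)\<close> shows that \<open>S1\<close> is the disjoint union of \<open>S2\<close> and \<open>r S1\<close>. Hence
  \<open>b\<close> has generating function \<open>(r - 1) D * U (r S1)\<close>, while both \<open>a\<close> and \<open>c\<close> have
  \<open>D * U (r S1)\<close>.
\<close>

section \<open>Weighted generating functions\<close>

unbundle fps_syntax

text \<open>\<open>d\<close> is the degree and \<open>w\<close> the weight. An infinite level set
  would yield the coefficient 0, so the union and product rules assume finite level sets.\<close>

definition gf :: "('a \<Rightarrow> nat) \<Rightarrow> 'a set \<Rightarrow> ('a \<Rightarrow> int) \<Rightarrow> int fps" where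
  "gf d X w = Abs_fps (\<lambda>n. \<Sum>x\<in>{x \<in> X. d x = n}. w x)"

lemma gf_nth: "gf d X w $ n = (\<Sum>x\<in>{x \<in> X. d x = n}. w x)"
  by (simp add: gf_def)

lemma gf_add: "gf d X (\<lambda>x. u x + v x) = gf d X u + gf d X v"
  by (rule fps_ext) (simp add: gf_nth sum.distrib)

lemma gf_scale: "gf d X (\<lambda>x. c * u x) = fps_const c * gf d X u"
  by (rule fps_ext) (simp add: gf_nth sum_distrib_left)

lemma gf_reindex:
  assumes bij: "bij_betw f X Y"
    and d: "\<And>x. x \<in> X \<Longrightarrow> d' (f x) = d x" and w: "\<And>x. x \<in> X \<Longrightarrow> w' (f x) = w x"
  shows "gf d' Y w' = gf d X w"
proof (rule fps_ext)
  fix n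
  have "bij_betw f {x \<in> X. d x = n} {y \<in> Y. d' y = n}"
    by (rule bij_betw_subset[OF bij]) (use bij d in \<open>auto simp: bij_betw_def\<close>)
  then show "gf d' Y w' $ n = gf d X w $ n"
    unfolding gf_nth by (subst sum.reindex_bij_betw[symmetric]) (auto intro!: sum.cong simp: w)
qed

lemma gf_Un_disjoint:
  assumes "X \<inter> Y = {}"
    and "\<And>n. finite {x \<in> X. d x = n}" and "\<And>n. finite {x \<in> Y. d x = n}"
  shows "gf d (X \<union> Y) w = gf d X w + gf d Y w"
proof (rule fps_ext)
  fix n
  have "{x \<in> X \<union> Y. d x = n} = {x \<in> X. d x = n} \<union> {x \<in> Y. d x = n}" by auto
  then show "gf d (X \<union> Y) w $ n = (gf d X w + gf d Y w) $ n"
    using assms by (simp add: gf_nth) (subst sum.union_disjoint, auto)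
qed

text \<open>A level set of the product is a disjoint union of rectangles indexed by the degree of
  the first component; summing over them is the Cauchy product.\<close>

lemma gf_Times:
  assumes X: "\<And>n. finite {x \<in> X. dx x = n}" and Y: "\<And>n. finite {y \<in> Y. dy y = n}"
  shows "gf (\<lambda>(x, y). dx x + dy y) (X \<times> Y) (\<lambda>(x, y). u x * v y) = gf dx X u * gf dy Y v"
proof (rule fps_ext)
  fix n
  let ?Z = "\<lambda>i. {x \<in> X. dx x = i} \<times> {y \<in> Y. dy y = n - i}"
  have eq: "{z \<in> X \<times> Y. (case z of (x, y) \<Rightarrow> dx x + dy y) = n} = (\<Union>i\<in>{0..n}. ?Z i)"
    by auto
  have "gf (\<lambda>(x, y). dx x + dy y) (X \<times> Y) (\<lambda>(x, y). u x * v y) $ n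
      = (\<Sum>i=0..n. \<Sum>z\<in>?Z i. case z of (x, y) \<Rightarrow> u x * v y)"
    unfolding gf_nth eq by (rule sum.UNION_disjoint) (auto simp: X Y)
  also have "\<dots> = (gf dx X u * gf dy Y v) $ n"
    by (simp add: fps_mult_nth gf_nth sum_product sum.cartesian_product)
  finally show "gf (\<lambda>(x, y). dx x + dy y) (X \<times> Y) (\<lambda>(x, y). u x * v y) $ n
      = (gf dx X u * gf dy Y v) $ n" .
qed

text \<open>Turns the decompositions below into product identities.\<close>

lemma gf_mult:
  assumes bij: "bij_betw f (X \<times> Y) Z"
    and X: "\<And>n. finite {x \<in> X. dx x = n}" and Y: "\<And>n. finite {y \<in> Y. dy y = n}"
    and d: "\<And>x y. x \<in> X \<Longrightarrow> y \<in> Y \<Longrightarrow> dz (f (x, y)) = dx x + dy y"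
    and w: "\<And>x y. x \<in> X \<Longrightarrow> y \<in> Y \<Longrightarrow> w (f (x, y)) = u x * v y"
  shows "gf dz Z w = gf dx X u * gf dy Y v"
  unfolding gf_Times[OF X Y, symmetric] by (rule gf_reindex[OF bij]) (auto simp: d w)

section \<open>Multisets in place of sorted lists\<close>

definition msets :: "nat set \<Rightarrow> nat multiset set" where
  "msets A = {M. set_mset M \<subseteq> A}"

definition one_part_msets :: "nat set \<Rightarrow> nat multiset set" where
  "one_part_msets A = {M. set_mset M \<subseteq> A \<and> card (set_mset M) = 1}"

definition bounded_msets :: "nat \<Rightarrow> nat set \<Rightarrow> nat multiset set" where
  "bounded_msets r A = {M. set_mset M \<subseteq> A \<and> (\<forall>p. count M p < r)}"

text \<open>A non-increasing list is the reverse of the sorted list of its own multiset, so the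
  order of the parts carries no information.\<close>

lemma bij_betw_mset_partitions:
  "bij_betw mset (partitions n) {M. 0 \<notin># M \<and> sum_mset M = n}"
proof (rule bij_betw_byWitness[where f' = "\<lambda>M. rev (sorted_list_of_multiset M)"])
  show "\<forall>xs\<in>partitions n. rev (sorted_list_of_multiset (mset xs)) = xs"
  proof
    fix xs assume "xs \<in> partitions n"
    then have "sorted (rev xs)" by (simp add: partitions_def sorted_wrt_rev)
    then have "sort xs = rev xs" by (intro properties_for_sort) auto
    then show "rev (sorted_list_of_multiset (mset xs)) = xs" by simp
  qed
  show "\<forall>M\<in>{M. 0 \<notin># M \<and> sum_mset M = n}. mset (rev (sorted_list_of_multiset M)) = M"
    by simp
  show "mset ` partitions n \<subseteq> {M. 0 \<notin># M \<and> sum_mset M = n}"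
    by (auto simp: partitions_def sum_mset_sum_list)
  show "(\<lambda>M. rev (sorted_list_of_multiset M)) ` {M. 0 \<notin># M \<and> sum_mset M = n} \<subseteq> partitions n"
    by (auto simp: partitions_def sorted_wrt_rev sum_mset_sum_list[symmetric] intro!: Nat.gr0I)
qed

lemma finite_sum_mset_eq:
  assumes "A \<subseteq> {1..}" and "X \<subseteq> msets A"
  shows "finite {M \<in> X. sum_mset M = n}"
proof (rule finite_subset)
  show "{M \<in> X. sum_mset M = n} \<subseteq> mset ` partitions n"
    using assms unfolding bij_betw_imp_surj_on[OF bij_betw_mset_partitions] msets_def by force
qed (simp add: finite_partitions)

text \<open>Bridge from lists to coefficients, for conditions \<open>Q\<close> that see only the
  multiset of parts. As \<open>A\<close> omits 0, every multiset in \<open>X\<close> comes from a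
  partition.\<close>

lemma sum_partitions_eq_gf:
  assumes A: "A \<subseteq> {1..}" and X: "X \<subseteq> msets A"
    and Q: "\<And>xs. Q xs \<longleftrightarrow> mset xs \<in> X"
  shows "(\<Sum>xs\<in>{xs \<in> partitions n. Q xs}. w (mset xs)) = gf sum_mset X w $ n"
proof -
  have "bij_betw mset {xs \<in> partitions n. Q xs} {M \<in> X. sum_mset M = n}"
  proof (rule bij_betw_subset[OF bij_betw_mset_partitions])
    have "0 \<notin># M" if "M \<in> X" for M
      using that A X by (force simp: msets_def)
    then have eq: "{M \<in> X. sum_mset M = n} = {M \<in> mset ` partitions n. M \<in> X}"
      unfolding bij_betw_imp_surj_on[OF bij_betw_mset_partitions] by blast
    show "mset ` {xs \<in> partitions n. Q xs} = {M \<in> X. sum_mset M = n}"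
      unfolding eq by (auto simp: Q)
  qed blast
  then show ?thesis unfolding gf_nth by (rule sum.reindex_bij_betw)
qed

lemma card_partitions_eq_gf:
  assumes "A \<subseteq> {1..}" and "X \<subseteq> msets A" and "\<And>xs. Q xs \<longleftrightarrow> mset xs \<in> X"
  shows "int (card {xs \<in> partitions n. Q xs}) = gf sum_mset X (\<lambda>_. 1) $ n"
  using sum_partitions_eq_gf[OF assms, of "\<lambda>_. 1" n] by simp

section \<open>Decompositions of multisets\<close>

text \<open>The sum runs over the support of \<open>M\<close> only; at any other \<open>q\<close>
  both sides are 0 because \<open>0 mod r = 0\<close>.\<close>

lemma count_mod_mset: "count (\<Sum>p\<in>set_mset M. replicate_mset (count M p mod r) p) q = count M q mod r"
  by (simp add: count_sum sum.delta' not_in_iff)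

lemma count_div_mset: "count (\<Sum>p\<in>set_mset M. replicate_mset (count M p div r) p) q = count M q div r"
  by (simp add: count_sum sum.delta' not_in_iff)

lemma set_mset_repeat_mset:
  assumes "r > 0"
  shows "set_mset (repeat_mset r M) = set_mset M"
proof -
  have "p \<in># repeat_mset r M \<longleftrightarrow> p \<in># M" for p
    using assms by (simp flip: count_greater_zero_iff)
  then show ?thesis by blast
qed

text \<open>Uniqueness of division with remainder, one multiplicity at a time: \<open>M\<close>
  holds the remainders and \<open>N\<close> the quotients.\<close>

lemma inj_on_bounded_add_repeat:
  "inj_on (\<lambda>(M, N). M + repeat_mset r N) (bounded_msets r A \<times> UNIV)"
proof (rule inj_onI, clarify)
  fix M N M' N' assume M: "M \<in> bounded_msets r A" "M' \<in> bounded_msets r A"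
    and eq: "M + repeat_mset r N = M' + repeat_mset r N'"
  have c: "count M p + r * count N p = count M' p + r * count N' p" for p
    using arg_cong[OF eq, of "\<lambda>K. count K p"] by simp
  have lt: "count M p < r" "count M' p < r" for p using M by (auto simp: bounded_msets_def)
  have "count M p = count M' p" for p
    using arg_cong[OF c, of "\<lambda>k. k mod r" p] lt[of p] by simp
  moreover have "count N p = count N' p" for p
    using arg_cong[OF c, of "\<lambda>k. k div r" p] lt[of p] by simp
  ultimately show "M = M' \<and> N = N'" by (simp add: multiset_eq_iff)
qed

lemma bij_betw_bounded_add_repeat:
  assumes "r > 0"
  shows "bij_betw (\<lambda>(M, N). M + repeat_mset r N) (bounded_msets r A \<times> msets A) (msets A)"
  unfolding bij_betw_def
proof (intro conjI subset_antisym subsetI)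
  show "inj_on (\<lambda>(M, N). M + repeat_mset r N) (bounded_msets r A \<times> msets A)"
    by (rule inj_on_subset[OF inj_on_bounded_add_repeat]) auto
next
  fix L assume L: "L \<in> msets A"
  let ?M = "\<Sum>p\<in>set_mset L. replicate_mset (count L p mod r) p"
  let ?N = "\<Sum>p\<in>set_mset L. replicate_mset (count L p div r) p"
  have "L = ?M + repeat_mset r ?N"
    by (simp add: multiset_eq_iff count_mod_mset count_div_mset)
  \<comment> \<open>A positive remainder or quotient forces a positive multiplicity in
    \<open>L\<close>, so no new part appears.\<close>
  moreover have "set_mset ?M \<subseteq> set_mset L" "set_mset ?N \<subseteq> set_mset L"
    by (auto simp del: count_greater_zero_iff simp: count_greater_zero_iff[symmetric]
        count_mod_mset count_div_mset intro!: Nat.gr0I)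
  then have "?M \<in> bounded_msets r A" "?N \<in> msets A"
    using L assms by (auto simp: bounded_msets_def msets_def count_mod_mset)
  ultimately show "L \<in> (\<lambda>(M, N). M + repeat_mset r N) ` (bounded_msets r A \<times> msets A)"
    by force
qed (use assms in \<open>auto simp: bounded_msets_def msets_def set_mset_repeat_mset\<close>)

text \<open>The inverse splits by membership in \<open>A\<close>; disjointness sends every part from
  \<open>B\<close> to the second component.\<close>

lemma bij_betw_add_mset_disjoint:
  assumes "A \<inter> B = {}"
  shows "bij_betw (\<lambda>(M, N). M + N) (msets A \<times> msets B) (msets (A \<union> B))"
proof (rule bij_betw_byWitness[where f' = "\<lambda>L. (filter_mset (\<lambda>p. p \<in> A) L, filter_mset (\<lambda>p. p \<notin> A) L)"])
  show "\<forall>z\<in>msets A \<times> msets B. (filter_mset (\<lambda>p. p \<in> A) (case z of (M, N) \<Rightarrow> M + N),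
      filter_mset (\<lambda>p. p \<notin> A) (case z of (M, N) \<Rightarrow> M + N)) = z"
    using assms by (auto simp: msets_def multiset_eq_iff count_eq_zero_iff)
qed (use assms in \<open>auto simp: msets_def\<close>)

text \<open>Such a \<open>K\<close> consists of \<open>k\<close> copies of a part \<open>p\<close>
  with 1 \<le> \<open>k\<close> \<le> \<open>count M p\<close>, and the multiplicities add up to the
  size.\<close>

lemma card_one_part_submsets:
  assumes "M \<in> msets A"
  shows "card {K \<in> one_part_msets A. K \<subseteq># M} = size M"
proof -
  have "bij_betw (\<lambda>(p, k). replicate_mset k p) (SIGMA p:set_mset M. {1..count M p})
      {K \<in> one_part_msets A. K \<subseteq># M}"
    unfolding bij_betw_def
  proof (intro conjI subset_antisym subsetI)
    show "inj_on (\<lambda>(p, k). replicate_mset k p) (SIGMA p:set_mset M. {1..count M p})"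
    proof (rule inj_onI, clarify)
      fix p k q l
      assume k: "k \<in> {1..count M p}" and "l \<in> {1..count M q}"
        and eq: "replicate_mset k p = replicate_mset l q"
      have "p \<in># replicate_mset k p" using k by simp
      then have "p = q" unfolding eq by (simp split: if_splits)
      moreover have "k = l" using arg_cong[OF eq, of size] by (simp only: size_replicate_mset)
      ultimately show "p = q \<and> k = l" by simp
    qed
  next
    fix K assume K: "K \<in> {K \<in> one_part_msets A. K \<subseteq># M}"
    then obtain p where p: "set_mset K = {p}" by (auto simp: one_part_msets_def card_1_singleton_iff)
    then have "K = replicate_mset (count K p) p"
      by (metis count_replicate_mset multiset_eq_iff not_in_iff singletonD)
    moreover have "p \<in># M" "count K p \<le> count M p" "count K p \<ge> 1"
      using K p by (auto simp: mset_subset_eqD mset_subset_eq_count Suc_le_eq)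
    ultimately show "K \<in> (\<lambda>(p, k). replicate_mset k p) ` (SIGMA p:set_mset M. {1..count M p})"
      by force
  qed (use assms in \<open>auto simp: one_part_msets_def msets_def subseteq_mset_def\<close>)
  from bij_betw_same_card[OF this] show ?thesis
    by (simp add: size_multiset_overloaded_eq)
qed

section \<open>Lengths by marking a block of equal parts\<close>

abbreviation part_gf :: "nat set \<Rightarrow> int fps" where
  "part_gf A \<equiv> gf sum_mset (msets A) (\<lambda>_. 1)"

abbreviation length_gf :: "nat set \<Rightarrow> int fps" where
  "length_gf A \<equiv> gf sum_mset (msets A) (\<lambda>M. int (size M))"

abbreviation one_part_gf :: "nat set \<Rightarrow> int fps" where
  "one_part_gf A \<equiv> gf sum_mset (one_part_msets A) (\<lambda>_. 1)"

abbreviation bounded_gf :: "nat \<Rightarrow> nat set \<Rightarrow> int fps" where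
  "bounded_gf r A \<equiv> gf sum_mset (bounded_msets r A) (\<lambda>_. 1)"

lemma one_part_msets_subset: "one_part_msets A \<subseteq> msets A"
  and bounded_msets_subset: "bounded_msets r A \<subseteq> msets A"
  by (auto simp: one_part_msets_def bounded_msets_def msets_def)

lemmas finite_levels =
  finite_sum_mset_eq[OF _ order_refl]
  finite_sum_mset_eq[OF _ one_part_msets_subset]
  finite_sum_mset_eq[OF _ bounded_msets_subset]

text \<open>Double counting of multisets \<open>M\<close> with a marked block \<open>K\<close>:
  removing \<open>K\<close> gives the product, while each \<open>M\<close> admits
  \<open>size M\<close> choices of \<open>K\<close>.\<close>

lemma length_gf_eq:
  assumes "A \<subseteq> {1..}"
  shows "length_gf A = part_gf A * one_part_gf A"
proof -
  let ?Z = "SIGMA M:msets A. {K \<in> one_part_msets A. K \<subseteq># M}"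
  have "bij_betw (\<lambda>(M, K). (M + K, K)) (msets A \<times> one_part_msets A) ?Z"
    by (rule bij_betw_byWitness[where f' = "\<lambda>(M, K). (M - K, K)"])
      (auto simp: msets_def one_part_msets_def dest: in_diffD)
  then have "gf (\<lambda>(M, K). sum_mset M) ?Z (\<lambda>_. 1) = part_gf A * one_part_gf A"
    by (rule gf_mult) (auto simp: finite_levels[OF assms])
  moreover have "gf (\<lambda>(M, K). sum_mset M) ?Z (\<lambda>_. 1) = length_gf A"
  proof (rule fps_ext)
    fix n
    \<comment> \<open>Infinite sets have \<open>card\<close> 0, so a positive cardinality already
      gives finiteness; only the empty multiset needs a separate case.\<close>
    have fin: "finite {K \<in> one_part_msets A. K \<subseteq># M}" if "M \<in> msets A" for M
    proof (cases "M = {#}")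
      case False
      then have "card {K \<in> one_part_msets A. K \<subseteq># M} > 0"
        by (simp add: card_one_part_submsets that nonempty_has_size)
      then show ?thesis by (rule card_ge_0_finite)
    qed simp
    have "{z \<in> ?Z. (case z of (M, K) \<Rightarrow> sum_mset M) = n}
        = (SIGMA M:{M \<in> msets A. sum_mset M = n}. {K \<in> one_part_msets A. K \<subseteq># M})"
      by auto
    then show "gf (\<lambda>(M, K). sum_mset M) ?Z (\<lambda>_. 1) $ n = length_gf A $ n"
      using finite_levels(1)[OF assms, of n] fin
      by (simp add: gf_nth card_one_part_submsets)
  qed
  ultimately show ?thesis by simp
qed

section \<open>Multiplying parts or multiplicities by r\<close>

context
  fixes r :: nat and A :: "nat set"
  assumes r: "r > 0" and A: "A \<subseteq> {1..}"
begin

lemma sum_mset_times: "sum_mset (image_mset ((*) r) M) = r * sum_mset M"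
  by (induction M) (auto simp: algebra_simps)

lemma sum_mset_repeat: "sum_mset (repeat_mset r M) = r * (sum_mset M :: nat)"
  by (induction r) auto

lemma bij_betw_image_times:
  "bij_betw (image_mset ((*) r)) (msets A) (msets ((*) r ` A))"
  using r by (intro bij_betw_byWitness[where f' = "image_mset (\<lambda>k. k div r)"])
    (auto simp: msets_def multiset.map_comp o_def subset_iff intro!: multiset.map_ident_strong,
      fastforce)

lemma image_times_subset: "(*) r ` A \<subseteq> {1..}"
  using A r by force

lemma finite_times_levels:
  assumes "X \<subseteq> msets A"
  shows "finite {M \<in> X. r * sum_mset M = n}"
  by (rule finite_subset[OF _ finite_sum_mset_eq[OF A assms, of "n div r"]]) (use r in auto)

text \<open>The degree \<open>r * sum_mset M\<close> arises from repeating each part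
  \<open>r\<close> times as well as from multiplying each part by \<open>r\<close>; this trades the
  first for the second. Scaling keeps the size, so any weight \<open>f (size M)\<close> is
  allowed.\<close>

lemma gf_times_msets:
  "gf (\<lambda>M. r * sum_mset M) (msets A) (\<lambda>M. f (size M)) =
    gf sum_mset (msets ((*) r ` A)) (\<lambda>M. f (size M))"
  by (rule gf_reindex[OF bij_betw_image_times, symmetric]) (auto simp: sum_mset_times)

text \<open>Multiplication by \<open>r > 0\<close> is injective and so preserves the number of
  distinct parts.\<close>

lemma gf_times_one_part:
  "gf (\<lambda>M. r * sum_mset M) (one_part_msets A) (\<lambda>_. 1) = one_part_gf ((*) r ` A)"
proof (rule gf_reindex[symmetric])
  have *: "card ((*) r ` set_mset M) = card (set_mset M)" for M
    using r by (intro card_image) (auto simp: inj_on_def)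
  show "bij_betw (image_mset ((*) r)) (one_part_msets A) (one_part_msets ((*) r ` A))"
  proof (rule bij_betw_subset[OF bij_betw_image_times one_part_msets_subset])
    show "image_mset ((*) r) ` one_part_msets A = one_part_msets ((*) r ` A)"
    proof (intro subset_antisym subsetI)
      fix N assume N: "N \<in> one_part_msets ((*) r ` A)"
      then obtain M where "M \<in> msets A" "N = image_mset ((*) r) M"
        using bij_betw_imp_surj_on[OF bij_betw_image_times] one_part_msets_subset by blast
      then show "N \<in> image_mset ((*) r) ` one_part_msets A"
        using N by (auto simp: one_part_msets_def msets_def *)
    qed (auto simp: one_part_msets_def * intro!: imageI)
  qed
qed (auto simp: sum_mset_times)

lemma part_gf_eq_bounded_mult: "part_gf A = bounded_gf r A * part_gf ((*) r ` A)"
  unfolding gf_times_msets[of "\<lambda>_. 1", symmetric]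
  by (rule gf_mult[OF bij_betw_bounded_add_repeat[OF r]])
    (auto simp: finite_levels[OF A] finite_times_levels sum_mset_repeat)

text \<open>The size of \<open>M + repeat_mset r N\<close> is \<open>size M + r * size N\<close>.
  Each summand depends on one component only, hence is a product weight.\<close>

lemma length_gf_eq_bounded:
  "length_gf A = gf sum_mset (bounded_msets r A) (\<lambda>M. int (size M)) * part_gf ((*) r ` A)
    + bounded_gf r A * (fps_const (int r) * length_gf ((*) r ` A))"
proof -
  define f where "f = (\<lambda>(M, N). M + repeat_mset r N :: nat multiset)"
  note bij = bij_betw_bounded_add_repeat[OF r, of A, folded f_def]
  have d: "sum_mset (f (M, N)) = sum_mset M + r * sum_mset N" for M N
    by (simp add: f_def sum_mset_repeat)
  have fin: "finite {M \<in> bounded_msets r A. sum_mset M = n}"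
    "finite {M \<in> msets A. r * sum_mset M = n}" for n
    by (auto simp: finite_levels[OF A] finite_times_levels)
  \<comment> \<open>\<open>g\<close> recovers the pair from the multiset, so that both summands
    become weights on \<open>msets A\<close>.\<close>
  define g where "g = inv_into (bounded_msets r A \<times> msets A) f"
  have g: "g (f z) = z" if "z \<in> bounded_msets r A \<times> msets A" for z
    unfolding g_def using bij that by (simp add: bij_betw_def)
  have "length_gf A = gf sum_mset (msets A)
      (\<lambda>L. int (size (fst (g L))) + int r * int (size (snd (g L))))"
  \<comment> \<open>Reindexing along the identity merely exchanges the weight.\<close>
  proof (rule gf_reindex[OF bij_betw_id])
    fix L assume "L \<in> msets A"
    then obtain M N where "L = f (M, N)" "(M, N) \<in> bounded_msets r A \<times> msets A"
      using bij_betw_imp_surj_on[OF bij] by (metis imageE surj_pair)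
    moreover from this have "g L = (M, N)" using g by simp
    ultimately show "int (size (id L)) = int (size (fst (g L))) + int r * int (size (snd (g L)))"
      by (simp add: f_def)
  qed simp
  also have "\<dots> = gf sum_mset (msets A) (\<lambda>L. int (size (fst (g L))))
      + gf sum_mset (msets A) (\<lambda>L. int r * int (size (snd (g L))))"
    by (rule gf_add)
  also have "gf sum_mset (msets A) (\<lambda>L. int (size (fst (g L)))) =
      gf sum_mset (bounded_msets r A) (\<lambda>M. int (size M)) *
      gf (\<lambda>M. r * sum_mset M) (msets A) (\<lambda>_. 1)"
    by (rule gf_mult[OF bij fin]) (auto simp: d g)
  also have "gf sum_mset (msets A) (\<lambda>L. int r * int (size (snd (g L)))) =
      bounded_gf r A * gf (\<lambda>M. r * sum_mset M) (msets A) (\<lambda>M. int r * int (size M))"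
    by (rule gf_mult[OF bij fin]) (auto simp: d g)
  finally show ?thesis
    unfolding gf_scale gf_times_msets[of "\<lambda>_. 1"] gf_times_msets[of int] .
qed

text \<open>In \<open>M + repeat_mset r N\<close> with \<open>M\<close> bounded, the parts of
  multiplicity at least \<open>r\<close> are exactly the parts of \<open>N\<close>.\<close>

lemma one_large_part_gf_eq:
  "gf sum_mset {M \<in> msets A. card {p \<in> set_mset M. count M p \<ge> r} = 1} (\<lambda>_. 1)
    = bounded_gf r A * one_part_gf ((*) r ` A)"
proof -
  let ?f = "\<lambda>(M, N). M + repeat_mset r N"
  let ?Z = "{M \<in> msets A. card {p \<in> set_mset M. count M p \<ge> r} = 1}"
  have large: "{p \<in> set_mset (M + repeat_mset r N). count (M + repeat_mset r N) p \<ge> r} = set_mset N"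
    if M: "M \<in> bounded_msets r A" for M N
  proof -
    have "p \<in># M + repeat_mset r N \<and> count (M + repeat_mset r N) p \<ge> r \<longleftrightarrow> p \<in># N" for p
    proof (cases "p \<in># N")
      case True
      then have "r * 1 \<le> r * count N p" by (intro mult_le_mono2) (simp add: Suc_le_eq)
      then show ?thesis using True r by (simp add: set_mset_repeat_mset trans_le_add2)
    next
      case False
      then have "count N p = 0" by (simp add: not_in_iff)
      then show ?thesis using M False by (auto simp: bounded_msets_def not_le[symmetric])
    qed
    then show ?thesis by blast
  qed
  have "bij_betw ?f (bounded_msets r A \<times> one_part_msets A) ?Z"
  proof (rule bij_betw_subset[OF bij_betw_bounded_add_repeat[OF r, of A]])
    show "?f ` (bounded_msets r A \<times> one_part_msets A) = ?Z"
    proof (intro subset_antisym subsetI)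
      fix L assume L: "L \<in> ?Z"
      then obtain M N where MN: "L = M + repeat_mset r N" "M \<in> bounded_msets r A" "N \<in> msets A"
        using bij_betw_imp_surj_on[OF bij_betw_bounded_add_repeat[OF r, of A]]
        by (smt (verit) SigmaE case_prod_conv imageE mem_Collect_eq)
      then have "N \<in> one_part_msets A"
        using L large by (simp add: one_part_msets_def msets_def)
      with MN show "L \<in> ?f ` (bounded_msets r A \<times> one_part_msets A)" by force
    next
      fix L assume "L \<in> ?f ` (bounded_msets r A \<times> one_part_msets A)"
      then obtain M N where MN: "L = M + repeat_mset r N" "M \<in> bounded_msets r A"
        "N \<in> one_part_msets A" by auto
      then have "L \<in> msets A"
        using r by (auto simp: one_part_msets_def msets_def bounded_msets_def set_mset_repeat_mset)
      moreover have "card {p \<in> set_mset L. count L p \<ge> r} = 1"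
        unfolding MN(1) large[OF MN(2)] using MN(3) by (simp add: one_part_msets_def)
      ultimately show "L \<in> ?Z" by simp
    qed
  qed (use one_part_msets_subset in auto)
  then show ?thesis unfolding gf_times_one_part[symmetric]
    by (rule gf_mult)
      (auto simp: finite_levels[OF A] finite_times_levels one_part_msets_subset sum_mset_repeat)
qed

end

section \<open>Disjoint unions of part sets\<close>

lemma part_gf_Un:
  assumes "A \<subseteq> {1..}" "B \<subseteq> {1..}" "A \<inter> B = {}"
  shows "part_gf (A \<union> B) = part_gf A * part_gf B"
  by (rule gf_mult[OF bij_betw_add_mset_disjoint[OF assms(3)]]) (auto simp: finite_levels[OF assms(1)] finite_levels[OF assms(2)])

text \<open>Applied with \<open>S2\<close> for \<open>A\<close> and \<open>r S1\<close> for
  \<open>B\<close> to obtain \<open>a_count\<close>: the distinct parts in \<open>B\<close> are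
  those of the second component.\<close>

lemma one_marked_part_gf_eq:
  assumes "A \<subseteq> {1..}" "B \<subseteq> {1..}" and disj: "A \<inter> B = {}"
  shows "gf sum_mset {M \<in> msets (A \<union> B). card (set_mset M \<inter> B) = 1} (\<lambda>_. 1)
    = part_gf A * one_part_gf B"
proof (rule gf_mult)
  let ?f = "\<lambda>(M, N). M + N :: nat multiset"
  let ?Z = "{M \<in> msets (A \<union> B). card (set_mset M \<inter> B) = 1}"
  have marked: "set_mset (M + N) \<inter> B = set_mset N" if "M \<in> msets A" "N \<in> msets B" for M N
    using that disj by (auto simp: msets_def)
  show "bij_betw ?f (msets A \<times> one_part_msets B) ?Z"
  proof (rule bij_betw_subset[OF bij_betw_add_mset_disjoint[OF disj]])
    show "?f ` (msets A \<times> one_part_msets B) = ?Z"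
    proof (intro subset_antisym subsetI)
      fix L assume L: "L \<in> ?Z"
      then obtain M N where MN: "L = M + N" "M \<in> msets A" "N \<in> msets B"
        using bij_betw_imp_surj_on[OF bij_betw_add_mset_disjoint[OF disj]]
        by (smt (verit) SigmaE case_prod_conv imageE mem_Collect_eq)
      then have "N \<in> one_part_msets B"
        using L marked by (simp add: one_part_msets_def msets_def)
      with MN show "L \<in> ?f ` (msets A \<times> one_part_msets B)" by force
    next
      fix L assume "L \<in> ?f ` (msets A \<times> one_part_msets B)"
      then obtain M N where MN: "L = M + N" "M \<in> msets A" "N \<in> one_part_msets B" by auto
      then have "N \<in> msets B" using one_part_msets_subset by auto
      then show "L \<in> ?Z"
        using MN marked[OF MN(2)] by (auto simp: one_part_msets_def msets_def)
    qed
  qed (use one_part_msets_subset in auto)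
qed (auto simp: finite_levels[OF assms(1)] finite_levels[OF assms(2)])

section \<open>Recovering part sets from coefficients\<close>

lemma sum_mset_eq_0_imp_empty:
  assumes "A \<subseteq> {1..}" and "M \<in> msets A" and "sum_mset M = 0"
  shows "M = {#}"
proof (rule ccontr)
  assume "M \<noteq> {#}"
  then obtain p where "p \<in># M" by blast
  then have "p = 0" "p \<ge> 1" using assms by (auto simp: msets_def)
  then show False by simp
qed

lemma part_gf_nth_0:
  assumes "A \<subseteq> {1..}"
  shows "part_gf A $ 0 = 1"
proof -
  have "{M \<in> msets A. sum_mset M = 0} = {{#}}"
    using sum_mset_eq_0_imp_empty[OF assms] by (auto simp: msets_def)
  then show ?thesis by (simp add: gf_nth)
qed

text \<open>A partition of \<open>k\<close> \<le> \<open>m\<close> that contains the part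
  \<open>m\<close> has no other part, which forces \<open>k = m\<close>.\<close>

lemma part_gf_nth_restrict:
  assumes A: "A \<subseteq> {1..}" and "k \<le> m"
  shows "part_gf A $ k = part_gf (A \<inter> {..<m}) $ k + of_bool (k = m \<and> m \<in> A)"
proof -
  let ?L = "{M \<in> msets A. sum_mset M = k}" and ?R = "{M \<in> msets (A \<inter> {..<m}). sum_mset M = k}"
  let ?T = "if k = m \<and> m \<in> A then {{#m#}} else {}"
  have "?L = ?R \<union> ?T"
  proof (intro subset_antisym subsetI)
    fix M assume M: "M \<in> ?L"
    show "M \<in> ?R \<union> ?T"
    proof (cases "m \<in># M")
      case True
      then obtain N where N: "M = add_mset m N" by (metis insert_DiffM)
      with M \<open>k \<le> m\<close> have "sum_mset N = 0" "k = m" "N \<in> msets A" by (auto simp: msets_def)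
      then have "N = {#}" by (intro sum_mset_eq_0_imp_empty[OF A])
      with N M \<open>k = m\<close> show ?thesis by (auto simp: msets_def)
    next
      case False
      have "p < m" if "p \<in># M" for p
      proof -
        have "p \<le> sum_mset M" using that by (simp add: sum_mset.remove)
        moreover have "p \<noteq> m" using that False by blast
        ultimately show ?thesis using M \<open>k \<le> m\<close> by simp
      qed
      then show ?thesis using M by (auto simp: msets_def)
    qed
  qed (auto simp: msets_def split: if_splits)
  moreover have "?R \<inter> ?T = {}" by (auto simp: msets_def)
  moreover have "finite ?R" using A by (intro finite_levels) auto
  ultimately have "card ?L = card ?R + card ?T" by (simp add: card_Un_disjoint)
  then show ?thesis by (simp add: gf_nth)
qed

text \<open>
  This yields the direction of Subbarao's theorem that is needed: whether \<open>m\<close> belongs to \<open>A\<close>, \<open>B\<close>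
  and \<open>C\<close> is read off from the \<open>m\<close>-th coefficients once this is known for all smaller numbers.
\<close>

lemma part_gf_mult_eq_imp_disjoint_Un:
  assumes A: "A \<subseteq> {1..}" and B: "B \<subseteq> {1..}" and C: "C \<subseteq> {1..}"
    and eq: "part_gf C = part_gf A * part_gf B"
  shows "A \<inter> B = {}" and "C = A \<union> B"
proof -
  \<comment> \<open>An indicator is at most 1, so this single equation encodes both disjointness and
    the union.\<close>
  have *: "of_bool (m \<in> C) = (of_bool (m \<in> A) + of_bool (m \<in> B) :: int)" for m
  proof (induction m rule: less_induct)
    case (less m)
    show ?case
    proof (cases "m = 0")
      case True
      with A B C show ?thesis by auto
    next
      case False
      let ?A = "A \<inter> {..<m}" and ?B = "B \<inter> {..<m}" and ?C = "C \<inter> {..<m}"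
      have "?A \<inter> ?B = {}" "?C = ?A \<union> ?B"
      proof -
        have "\<not> (k \<in> A \<and> k \<in> B)" "k \<in> C \<longleftrightarrow> k \<in> A \<or> k \<in> B" if "k < m" for k
          using less[OF that] by (auto simp: of_bool_def split: if_splits)
        then show "?A \<inter> ?B = {}" "?C = ?A \<union> ?B" by blast+
      qed
      then have eq': "part_gf ?C = part_gf ?A * part_gf ?B"
        using A B part_gf_Un[of ?A ?B] by auto
      have "part_gf C $ m = (\<Sum>i=0..m. (part_gf ?A $ i + of_bool (i = m \<and> m \<in> A)) *
          (part_gf ?B $ (m - i) + of_bool (m - i = m \<and> m \<in> B)))"
        unfolding eq fps_mult_nth
        by (intro sum.cong refl arg_cong2[of _ _ _ _ "(*)"] part_gf_nth_restrict A B) auto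
      \<comment> \<open>As \<open>m > 0\<close>, the indices 0 and \<open>m\<close> differ, so the
        product of the two indicators never survives.\<close>
      also have "\<dots> = (\<Sum>i=0..m. part_gf ?A $ i * part_gf ?B $ (m - i)
          + (if i = m then of_bool (m \<in> A) * part_gf ?B $ 0 else 0)
          + (if i = 0 then part_gf ?A $ 0 * of_bool (m \<in> B) else 0))"
        using False by (intro sum.cong refl) (auto simp: algebra_simps)
      also have "\<dots> = part_gf ?C $ m + of_bool (m \<in> A) + of_bool (m \<in> B)"
        using A B part_gf_nth_0[of ?A] part_gf_nth_0[of ?B]
        by (simp add: sum.distrib eq' fps_mult_nth le_infI1)
      \<comment> \<open>The same coefficient is also \<open>part_gf ?C $ m\<close> plus the
        indicator of \<open>m\<close> in \<open>C\<close>.\<close>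
      finally show ?thesis using part_gf_nth_restrict[OF C, of m m] by simp
    qed
  qed
  have "\<not> (m \<in> A \<and> m \<in> B)" "m \<in> C \<longleftrightarrow> m \<in> A \<or> m \<in> B" for m
    using *[of m] by (auto simp: of_bool_def split: if_splits)
  then show "A \<inter> B = {}" "C = A \<union> B" by blast+
qed

section \<open>Euler pairs and the three counts\<close>

theorem theorem1p2:
  fixes n r :: nat and S1 S2 :: "nat set"
  assumes "r \<ge> 2" and "euler_pair r S1 S2"
  shows "real (a_count r S1 n) = 1 / (real r - 1) * real_of_int (b_diff r S1 S2 n)
    \<and> real (c_count r S1 n) = 1 / (real r - 1) * real_of_int (b_diff r S1 S2 n)"
proof -
  let ?R = "(*) r ` S1"
  let ?LD = "gf sum_mset (bounded_msets r S1) (\<lambda>M. int (size M))"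
  have r: "r > 0" using assms by simp
  have S: "S1 \<subseteq> {1..}" "S2 \<subseteq> {1..}"
    and euler: "card (O_parts S2 n) = card (D_parts r S1 n)" for n
    using assms by (auto simp: euler_pair_def)
  have R: "?R \<subseteq> {1..}" by (rule image_times_subset[OF r S(1)])
  have O_iff: "set xs \<subseteq> S2 \<longleftrightarrow> mset xs \<in> msets S2" for xs
    by (simp add: msets_def)
  have D_iff: "set xs \<subseteq> S1 \<and> (\<forall>p\<in>set xs. count_list xs p \<le> r - 1)
      \<longleftrightarrow> mset xs \<in> bounded_msets r S1" for xs
  proof -
    \<comment> \<open>Numbers outside the list have count 0, which is below \<open>r\<close> since
      \<open>r > 0\<close>.\<close>
    have "(\<forall>p\<in>set xs. count_list xs p \<le> r - 1) \<longleftrightarrow> (\<forall>p. count_list xs p < r)"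
      using r by (metis One_nat_def Suc_pred count_notin less_Suc_eq_le)
    then show ?thesis by (simp add: bounded_msets_def count_mset)
  qed
  have D: "part_gf S2 = bounded_gf r S1"
    using euler card_partitions_eq_gf[OF S(2) order_refl O_iff]
      card_partitions_eq_gf[OF S(1) bounded_msets_subset D_iff]
    by (intro fps_ext) (simp add: O_parts_def D_parts_def)
  \<comment> \<open>With \<open>D\<close>, division with remainder reads
    \<open>part_gf S1 = part_gf S2 * part_gf ?R\<close>, from which the sets are recovered.\<close>
  have split: "S2 \<inter> ?R = {}" "S1 = S2 \<union> ?R"
    using part_gf_mult_eq_imp_disjoint_Un[OF S(2) R S(1)]
      part_gf_eq_bounded_mult[OF r S(1), folded D] by blast+
  have a: "int (a_count r S1 n) = (part_gf S2 * one_part_gf ?R) $ n"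
    unfolding a_count_def O1_parts_def
      one_marked_part_gf_eq[OF S(2) R split(1), folded split(2), symmetric]
    by (rule card_partitions_eq_gf[OF S(1)]) (auto simp: msets_def)
  have c: "int (c_count r S1 n) = (part_gf S2 * one_part_gf ?R) $ n"
    unfolding c_count_def D1_parts_def D one_large_part_gf_eq[OF r S(1), symmetric]
    by (rule card_partitions_eq_gf[OF S(1)]) (auto simp: msets_def count_mset)
  have b: "b_diff r S1 S2 n = (length_gf S2 - ?LD) $ n"
    using sum_partitions_eq_gf[OF S(2) order_refl O_iff, of "\<lambda>M. int (size M)" n]
      sum_partitions_eq_gf[OF S(1) bounded_msets_subset D_iff, of "\<lambda>M. int (size M)" n]
    by (simp add: b_diff_def O_parts_def D_parts_def)
  have U: "one_part_gf S1 = one_part_gf S2 + one_part_gf ?R"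
  proof -
    have "one_part_msets (A \<union> B) = one_part_msets A \<union> one_part_msets B" for A B
      by (auto simp: one_part_msets_def card_1_singleton_iff)
    then have "one_part_msets S1 = one_part_msets S2 \<union> one_part_msets ?R"
      using split(2) by metis
    moreover have "one_part_msets S2 \<inter> one_part_msets ?R = {}"
      using split(1) by (force simp: one_part_msets_def card_1_singleton_iff)
    ultimately show ?thesis using S R
      by (simp only:) (rule gf_Un_disjoint; simp add: finite_levels[OF S(2)] finite_levels[OF R])
  qed
  define P where "P = part_gf ?R"
  \<comment> \<open>The constant coefficient is 1; \<open>P\<close> can then be cancelled, integer
    power series having no zero divisors.\<close>
  have "P \<noteq> 0" using part_gf_nth_0[OF R] by (auto simp: P_def)
  \<comment> \<open>Two evaluations of \<open>length_gf S1\<close>: by marking a block, and by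
    division with remainder.\<close>
  have "part_gf S2 * P * one_part_gf S1 =
      ?LD * P + part_gf S2 * (fps_const (int r) * (P * one_part_gf ?R))"
    using length_gf_eq_bounded[OF r S(1)]
    unfolding length_gf_eq[OF S(1)] length_gf_eq[OF R] part_gf_eq_bounded_mult[OF r S(1)] D P_def .
  then have "P * ?LD = P * (part_gf S2 * one_part_gf S1
      - fps_const (int r) * (part_gf S2 * one_part_gf ?R))"
    by (simp add: algebra_simps)
  then have LD: "?LD = part_gf S2 * one_part_gf S1
      - fps_const (int r) * (part_gf S2 * one_part_gf ?R)"
    using \<open>P \<noteq> 0\<close> by simp
  \<comment> \<open>By \<open>U\<close>, the terms with \<open>one_part_gf S2\<close> cancel,
    leaving \<open>r\<close> copies minus one.\<close>
  have "length_gf S2 - ?LD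
      = fps_const (int r) * (part_gf S2 * one_part_gf ?R) - part_gf S2 * one_part_gf ?R"
    unfolding LD U length_gf_eq[OF S(2)] by (simp add: algebra_simps)
  then have "b_diff r S1 S2 n = (int r - 1) * (part_gf S2 * one_part_gf ?R) $ n"
    unfolding b by (simp add: left_diff_distrib)
  then have "b_diff r S1 S2 n = (int r - 1) * int (a_count r S1 n)"
    and "c_count r S1 n = a_count r S1 n"
    using a c by simp_all
  \<comment> \<open>Since \<open>r\<close> \<ge> 2, the factor \<open>r - 1\<close> is nonzero and
    can be divided out.\<close>
  then show ?thesis using assms(1) by simp
qed

end
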